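(* Let $0<\varphi<\frac{\pi}{2}$, $c=\cos\varphi$, $s=\sin\varphi=\sqrt{1-c^2}$, and consider quartic $G^2$ approximants, with parameter $\xi>0$, of the circular arc $\alpha\mapsto(\cos\alpha,\sin\alpha)^T$, $\alpha\in[-\varphi,\varphi]$. The optimal inner approximant is induced by $$\xi^\lor=\tfrac12\left(c\sqrt{1-c^2}+\sqrt{3-8c+6c^2-c^4}\right).$$ Moreover, in the limit $c\to0$, $\xi^\lor\to\frac{\sqrt3}{2}$ and the abscissa of the control point $b_2$ satisfies $\frac{3-4(\xi^\lor)^2}{3c}\to\frac23(4-\sqrt3)$.
   Context: For $c>0$ and real $\xi>0$, the quartic $G^2$ approximant with parameter $\xi$ is the curve $p:[-1,1]\to\mathbb{R}^2$, $p(t)=\sum_{i=0}^4\binom{4}{i}\left(\frac{1+t}{2}\right)^i\left(\frac{1-t}{2}\right)^{4-i}b_i$, with control points $b_0=(c,-s)^T$, $b_1=(c,-s)^T+\xi(s,c)^T$, $b_2=\left(\frac{3-4\xi^2}{3c},0\right)^T$, $b_3=(c,s)^T+\xi(s,-c)^T$, $b_4=(c,s)^T$. Its simplified radial error function is $\psi(t,\xi)=\|p(t)\|_2^2-1$. The approximant is inner if $\psi(t,\xi)\le0$ for all $t\in[-1,1]$. An inner approximant is optimal if it minimizes $\max_{t\in[-1,1]}|\psi(t,\xi)|$ among all inner approximants of this form. *)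

theory Defs
  imports "HOL-Analysis.Analysis"
begin

text \<open>
  Quartic \<open>G\<^sup>2\<close> approximants of the arc \<open>\<alpha> \<mapsto> (cos \<alpha>, sin \<alpha>)\<close>, \<open>\<alpha> \<in> [-\<phi>, \<phi>]\<close>, in Bezier form
  over \<open>[-1, 1]\<close>. Throughout, \<open>c\<close> and \<open>s\<close> stand for \<open>cos \<phi>\<close> and \<open>sin \<phi>\<close>, so \<open>s = sqrt (1 - c\<^sup>2)\<close>.
  The position of \<open>b\<^sub>2\<close> (for \<open>c > 0\<close>) is forced by matching the curvature of the arc at both ends.
\<close>

definition control_point :: "real \<Rightarrow> real \<Rightarrow> real \<Rightarrow> nat \<Rightarrow> real^2" where
  "control_point c s \<xi> i =
     [vector [c, - s],
      vector [c, - s] + \<xi> *\<^sub>R vector [s, c],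
      vector [(3 - 4 * \<xi>\<^sup>2) / (3 * c), 0],
      vector [c, s] + \<xi> *\<^sub>R vector [s, - c],
      vector [c, s]] ! i"

definition approximant :: "real \<Rightarrow> real \<Rightarrow> real \<Rightarrow> real \<Rightarrow> real^2" where
  "approximant c s \<xi> t =
     (\<Sum>i=0..4. (real (4 choose i) * ((1 + t) / 2) ^ i * ((1 - t) / 2) ^ (4 - i)) *\<^sub>R
                control_point c s \<xi> i)"

definition radial_error :: "real \<Rightarrow> real \<Rightarrow> real \<Rightarrow> real \<Rightarrow> real" where
  "radial_error c s t \<xi> = (norm (approximant c s \<xi> t))\<^sup>2 - 1"

definition inner_approximant :: "real \<Rightarrow> real \<Rightarrow> real \<Rightarrow> bool" where
  "inner_approximant c s \<xi> \<longleftrightarrow> \<xi> > 0 \<and> (\<forall>t\<in>{-1..1}. radial_error c s t \<xi> \<le> 0)"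

text \<open>The radial error is a polynomial in \<open>t\<close>, so the supremum below is attained.\<close>

definition max_radial_error :: "real \<Rightarrow> real \<Rightarrow> real \<Rightarrow> real" where
  "max_radial_error c s \<xi> = (SUP t\<in>{-1..1}. \<bar>radial_error c s t \<xi>\<bar>)"

definition optimal_inner_approximant :: "real \<Rightarrow> real \<Rightarrow> real \<Rightarrow> bool" where
  "optimal_inner_approximant c s \<xi> \<longleftrightarrow>
     inner_approximant c s \<xi> \<and>
     (\<forall>\<eta>. inner_approximant c s \<eta> \<longrightarrow> max_radial_error c s \<xi> \<le> max_radial_error c s \<eta>)"

definition xi_inner :: "real \<Rightarrow> real" where
  "xi_inner c = 1/2 * (c * sqrt (1 - c\<^sup>2) + sqrt (3 - 8 * c + 6 * c\<^sup>2 - c ^ 4))"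

end

theory Submission
  imports Defs
begin

text \<open>
  With \<open>u = (1 - t\<^sup>2) / 4\<close> the radial error is \<open>u\<^sup>3 (K\<^sup>2 u - a)\<close>, where \<open>K\<close> and \<open>a\<close> depend only on
  \<open>\<xi>\<close>; hence the approximant is inner iff \<open>K\<^sup>2 \<le> 4 a\<close>, the condition at the midpoint \<open>t = 0\<close>.
  At the claimed optimum \<open>\<xi>\<^sub>0\<close> the curve touches the circle in \<open>(1, 0)\<close>, so \<open>K\<^sup>2 = 4 a\<close>, and the
  error \<open>K\<^sup>2 u\<^sup>3 (1/4 - u)\<close> is largest at \<open>u = 3/16\<close>, i.e. \<open>t = 1/2\<close>. Every other inner
  approximant already has a larger error at this same \<open>t\<close>, which is proportional to
  \<open>a - 3/16 K\<^sup>2\<close>: if \<open>K\<^sup>2\<close> exceeds its value at \<open>\<xi>\<^sub>0\<close>, because \<open>a - 3/16 K\<^sup>2 \<ge> K\<^sup>2 / 16\<close>;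
  otherwise \<open>\<xi> > \<xi>\<^sub>0\<close>, since \<open>K\<close> is decreasing and positive at \<open>\<xi>\<^sub>0\<close>, and \<open>c a\<close> is a cubic in
  \<open>\<xi>\<close> that increases beyond \<open>\<xi>\<^sub>0\<close>.
\<close>

section \<open>The radial error as a polynomial\<close>

definition quartic_coeff :: "real \<Rightarrow> real \<Rightarrow> real \<Rightarrow> real" where
  "quartic_coeff c s \<xi> = 2 * (3 - 4 * \<xi>\<^sup>2) / c - 6 * c - 8 * \<xi> * s"

text \<open>The \<open>a\<close> of the overview, minus the coefficient of u^3 in the radial error;
  \<open>quartic_coeff\<close> is \<open>K\<close>, whose square is the coefficient of u^4.\<close>

definition cubic_coeff :: "real \<Rightarrow> real \<Rightarrow> real \<Rightarrow> real" where
  "cubic_coeff c s \<xi> = 16 * (s - 2 * \<xi> * c)\<^sup>2 - 8 * \<xi> * s * quartic_coeff c s \<xi>"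

text \<open>The control polygon is symmetric about the first axis, so t \<mapsto> -t fixes the first
  coordinate and negates the second. One is therefore a polynomial in u, the other t times such a
  polynomial.\<close>

lemma approximant_components:
  fixes c s \<xi> t :: real
  defines "u \<equiv> (1 - t\<^sup>2) / 4"
  shows "approximant c s \<xi> t $ 1 = c + 4 * \<xi> * s * u + quartic_coeff c s \<xi> * u\<^sup>2"
    and "approximant c s \<xi> t $ 2 = t * (s + u * (2 * s - 4 * \<xi> * c))"
proof -
  define X where "X = (3 - 4 * \<xi>\<^sup>2) / (3 * c)"
  have K: "quartic_coeff c s \<xi> = 6 * X - 6 * c - 8 * \<xi> * s"
    \<comment> \<open>For c = 0 both quotients are 0 by convention, so the identity
      persists.\<close>
    by (cases "c = 0") (simp_all add: quartic_coeff_def X_def field_simps)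
  have sum5: "(\<Sum>i=0..4. f i) = f 0 + f 1 + f 2 + f 3 + f 4" for f :: "nat \<Rightarrow> real"
    by (simp add: eval_nat_numeral)
  have choose: "(4 choose 2 :: nat) = 6" "(4 choose 3 :: nat) = 4"
    by (simp_all add: eval_nat_numeral)
  show "approximant c s \<xi> t $ 1 = c + 4 * \<xi> * s * u + quartic_coeff c s \<xi> * u\<^sup>2"
    unfolding K u_def approximant_def control_point_def X_def [symmetric] sum_component sum5
    by (simp add: choose vector_2 eval_nat_numeral) (simp add: field_simps)
  show "approximant c s \<xi> t $ 2 = t * (s + u * (2 * s - 4 * \<xi> * c))"
    unfolding u_def approximant_def control_point_def X_def [symmetric] sum_component sum5
    by (simp add: choose vector_2 eval_nat_numeral) (simp add: field_simps)
qed

lemma mult_quartic_coeff: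
  assumes "c \<noteq> 0" "s\<^sup>2 + c\<^sup>2 = 1"
  shows "c * quartic_coeff c s \<xi> = 6 * s\<^sup>2 - 8 * \<xi> * s * c - 8 * \<xi>\<^sup>2"
proof -
  have "c * quartic_coeff c s \<xi> = 6 - 8 * \<xi>\<^sup>2 - 6 * c\<^sup>2 - 8 * \<xi> * s * c"
    using assms(1) by (simp add: quartic_coeff_def field_simps power2_eq_square)
  with assms(2) show ?thesis by algebra
qed

text \<open>The coefficients of 1 and u cancel by s^2 + c^2 = 1. That of u^2 cancels by
  \<open>mult_quartic_coeff\<close>, which encodes the curvature condition on b_2.\<close>

lemma radial_error_eq:
  fixes c s \<xi> t :: real
  assumes "c \<noteq> 0" "s\<^sup>2 + c\<^sup>2 = 1"
  defines "u \<equiv> (1 - t\<^sup>2) / 4"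
  shows "radial_error c s t \<xi> = u ^ 3 * (quartic_coeff c s \<xi> ^ 2 * u - cubic_coeff c s \<xi>)"
proof -
  define K where "K = quartic_coeff c s \<xi>"
  have K: "c * K = 6 * s\<^sup>2 - 8 * \<xi> * s * c - 8 * \<xi>\<^sup>2"
    unfolding K_def using mult_quartic_coeff assms by blast
  have t: "t\<^sup>2 = 1 - 4 * u" by (simp add: u_def field_simps)
  have "radial_error c s t \<xi> = (approximant c s \<xi> t $ 1)\<^sup>2 + (approximant c s \<xi> t $ 2)\<^sup>2 - 1"
    unfolding radial_error_def
    by (simp only: power2_norm_eq_inner) (simp add: inner_vec_def sum_2 power2_eq_square)
  also have "\<dots> = (c + 4 * \<xi> * s * u + K * u\<^sup>2)\<^sup>2 + (t * (s + u * (2 * s - 4 * \<xi> * c)))\<^sup>2 - 1"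
    unfolding approximant_components K_def u_def ..
  also have "\<dots> = (c + 4 * \<xi> * s * u + K * u\<^sup>2)\<^sup>2
      + (1 - 4 * u) * (s + u * (2 * s - 4 * \<xi> * c))\<^sup>2 - 1"
    by (simp add: power_mult_distrib t)
  also have "\<dots> = u ^ 3 * (K\<^sup>2 * u - (16 * (s - 2 * \<xi> * c)\<^sup>2 - 8 * \<xi> * s * K))"
    using K assms(2) by algebra
  finally show ?thesis by (simp add: K_def cubic_coeff_def)
qed

text \<open>Both sides are 64 times the error at t = 0, where u = 1/4 and the curve crosses the
  first axis at abscissa c + \<xi> s + K/16.\<close>

lemma radial_error_0:
  assumes "c \<noteq> 0" "s\<^sup>2 + c\<^sup>2 = 1"
  shows "quartic_coeff c s \<xi> ^ 2 / 4 - cubic_coeff c s \<xi>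
    = 64 * ((c + \<xi> * s + quartic_coeff c s \<xi> / 16)\<^sup>2 - 1)"
proof -
  define K where "K = quartic_coeff c s \<xi>"
  have K: "c * K = 6 * s\<^sup>2 - 8 * \<xi> * s * c - 8 * \<xi>\<^sup>2"
    unfolding K_def using mult_quartic_coeff assms by blast
  have "K\<^sup>2 - 4 * (16 * (s - 2 * \<xi> * c)\<^sup>2 - 8 * \<xi> * s * K) = (16 * c + 16 * \<xi> * s + K)\<^sup>2 - 256"
    using K assms(2) by algebra
  also have "16 * c + 16 * \<xi> * s + K = 16 * (c + \<xi> * s + K / 16)" by simp
  also have "\<dots>\<^sup>2 = 256 * (c + \<xi> * s + K / 16)\<^sup>2" by (simp only: power_mult_distrib) simp
  finally have *: "K\<^sup>2 - 4 * cubic_coeff c s \<xi> = 256 * (c + \<xi> * s + K / 16)\<^sup>2 - 256"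
    unfolding K_def cubic_coeff_def .
  have "x / 4 - a = 64 * (y - 1)" if "x - 4 * a = 256 * y - 256" for x a y :: real
    using that by simp
  from this [OF *] show ?thesis unfolding K_def .
qed

text \<open>The factor K^2 u - a is nondecreasing in u, and u runs through [0, 1/4] with its maximum
  at t = 0.\<close>

lemma inner_approximant_iff:
  assumes "c \<noteq> 0" "s\<^sup>2 + c\<^sup>2 = 1"
  shows "inner_approximant c s \<xi> \<longleftrightarrow> \<xi> > 0 \<and> quartic_coeff c s \<xi> ^ 2 \<le> 4 * cubic_coeff c s \<xi>"
proof -
  let ?K = "quartic_coeff c s \<xi>" and ?a = "cubic_coeff c s \<xi>"
  have "(\<forall>t\<in>{-1..1}. radial_error c s t \<xi> \<le> 0) \<longleftrightarrow> ?K\<^sup>2 \<le> 4 * ?a"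
  proof
    assume "\<forall>t\<in>{-1..1}. radial_error c s t \<xi> \<le> 0"
    then have "radial_error c s 0 \<xi> \<le> 0" by simp
    then show "?K\<^sup>2 \<le> 4 * ?a" by (simp add: radial_error_eq [OF assms] power3_eq_cube)
  next
    assume *: "?K\<^sup>2 \<le> 4 * ?a"
    show "\<forall>t\<in>{-1..1}. radial_error c s t \<xi> \<le> 0"
    proof
      fix t :: real assume "t \<in> {-1..1}"
      then have "t\<^sup>2 \<le> 1" by (simp add: abs_square_le_1 abs_le_iff)
      then have u: "0 \<le> (1 - t\<^sup>2) / 4" "(1 - t\<^sup>2) / 4 \<le> 1 / 4" by simp_all
      have "?K\<^sup>2 * ((1 - t\<^sup>2) / 4) \<le> ?K\<^sup>2 * (1 / 4)"
        using u(2) by (intro mult_left_mono) auto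
      with * have "?K\<^sup>2 * ((1 - t\<^sup>2) / 4) - ?a \<le> 0" by simp
      with u(1) show "radial_error c s t \<xi> \<le> 0"
        unfolding radial_error_eq [OF assms] by (intro mult_nonneg_nonpos) auto
    qed
  qed
  then show ?thesis by (simp add: inner_approximant_def)
qed

section \<open>The maximal error\<close>

lemma radial_error_le_max:
  assumes "c \<noteq> 0" "s\<^sup>2 + c\<^sup>2 = 1" "t \<in> {-1..1}"
  shows "\<bar>radial_error c s t \<xi>\<bar> \<le> max_radial_error c s \<xi>"
proof -
  have "continuous_on {-1..1::real} (\<lambda>t. \<bar>radial_error c s t \<xi>\<bar>)"
    unfolding radial_error_eq [OF assms(1,2)] by (intro continuous_intros) auto
  then have "bounded ((\<lambda>t. \<bar>radial_error c s t \<xi>\<bar>) ` {-1..1})"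
    by (intro compact_imp_bounded compact_continuous_image) auto
  then show ?thesis
    unfolding max_radial_error_def
    by (intro cSUP_upper assms(3) bounded_imp_bdd_above)
qed

lemma radial_error_half:
  assumes "c \<noteq> 0" "s\<^sup>2 + c\<^sup>2 = 1"
  shows "radial_error c s (1/2) \<xi>
    = - (27 / 4096) * (cubic_coeff c s \<xi> - 3 / 16 * quartic_coeff c s \<xi> ^ 2)"
  by (simp add: radial_error_eq [OF assms] power2_eq_square power3_eq_cube field_simps)

lemma cube_mult_quarter_minus_le:
  fixes u :: real
  shows "u ^ 3 * (1 / 4 - u) \<le> 27 / 65536"
proof -
  \<comment> \<open>The maximum of u^3 (1/4 - u) is at the critical point 3/16, hence the double
    root there.\<close>
  have "27 / 65536 - u ^ 3 * (1 / 4 - u)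
      = (u - 3 / 16)\<^sup>2 * ((u + 1 / 16)\<^sup>2 + 1 / 128)"
    by algebra
  also have "\<dots> \<ge> 0" by simp
  finally show ?thesis by simp
qed

lemma max_radial_error_eq_half:
  assumes "c \<noteq> 0" "s\<^sup>2 + c\<^sup>2 = 1" and a: "4 * cubic_coeff c s \<xi> = quartic_coeff c s \<xi> ^ 2"
  shows "max_radial_error c s \<xi> = \<bar>radial_error c s (1/2) \<xi>\<bar>"
proof (rule antisym)
  let ?K = "quartic_coeff c s \<xi>"
  show "max_radial_error c s \<xi> \<le> \<bar>radial_error c s (1/2) \<xi>\<bar>"
    unfolding max_radial_error_def
  proof (rule cSUP_least)
    fix t :: real assume "t \<in> {-1..1}"
    then have "t\<^sup>2 \<le> 1" by (simp add: abs_square_le_1 abs_le_iff)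
    define u where "u = (1 - t\<^sup>2) / 4"
    have u: "0 \<le> u" "u \<le> 1 / 4" using \<open>t\<^sup>2 \<le> 1\<close> by (simp_all add: u_def)
    have "radial_error c s t \<xi> = - (?K\<^sup>2 * (u ^ 3 * (1 / 4 - u)))"
      unfolding radial_error_eq [OF assms(1,2)] u_def [symmetric] using a by algebra
    then have "\<bar>radial_error c s t \<xi>\<bar> = ?K\<^sup>2 * (u ^ 3 * (1 / 4 - u))"
      using u by (simp add: abs_mult)
    also have "\<dots> \<le> ?K\<^sup>2 * (27 / 65536)"
      by (intro mult_left_mono cube_mult_quarter_minus_le) simp
    also have "\<dots> = \<bar>- (27 / 4096) * (?K\<^sup>2 / 4 - 3 / 16 * ?K\<^sup>2)\<bar>"
      by (simp add: abs_mult)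
    also have "\<dots> = \<bar>radial_error c s (1/2) \<xi>\<bar>"
      unfolding radial_error_half [OF assms(1,2)] a [symmetric] by simp
    finally show "\<bar>radial_error c s t \<xi>\<bar> \<le> \<bar>radial_error c s (1/2) \<xi>\<bar>" .
  qed simp
qed (use radial_error_le_max [OF assms(1,2), of "1/2"] in simp)

section \<open>The coefficients at the claimed optimum\<close>

lemma quartic_coeff_strict_antimono:
  assumes "c > 0" "s > 0" "0 < \<xi>" "\<xi> < \<eta>"
  shows "quartic_coeff c s \<eta> < quartic_coeff c s \<xi>"
proof -
  have "\<xi>\<^sup>2 < \<eta>\<^sup>2" using assms by (intro power_strict_mono) auto
  then have "2 * (3 - 4 * \<eta>\<^sup>2) / c < 2 * (3 - 4 * \<xi>\<^sup>2) / c"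
    using assms by (intro divide_strict_right_mono) auto
  moreover have "8 * \<xi> * s < 8 * \<eta> * s" using assms by simp
  ultimately show ?thesis by (simp add: quartic_coeff_def)
qed

lemma less_one_of_unit_circle:
  fixes c s :: real
  assumes "0 < s" "s\<^sup>2 + c\<^sup>2 = 1"
  shows "c < 1"
proof -
  have "0 < s\<^sup>2" using assms(1) by simp
  with assms(2) have "c\<^sup>2 < 1" by linarith
  then show ?thesis by (simp add: abs_square_less_1)
qed

lemma radicand_factor: "3 - 8 * c + 6 * c\<^sup>2 - c ^ 4 = (1 - c) ^ 3 * (3 + c)" for c :: real
  by algebra

text \<open>Here \<open>\<delta>\<close> is half the second square root in \<open>xi_inner\<close>.
  The lower bound serves the slope estimate for the cubic, the upper bound the positivity of
  K.\<close>

lemma xi_inner_bounds: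
  assumes "0 < c" "0 < s" "s\<^sup>2 + c\<^sup>2 = 1"
  defines "\<delta> \<equiv> xi_inner c - s * c / 2"
  shows "4 * \<delta>\<^sup>2 = (1 - c) ^ 3 * (3 + c)"
    and "7 / 10 * (1 - c) * s \<le> \<delta>"
    and "2 * (s * \<delta>) < (1 - c)\<^sup>2 * (2 + c)"
proof -
  have c1: "c < 1" using less_one_of_unit_circle assms by blast
  have s: "sqrt (1 - c\<^sup>2) = s"
    using assms by (intro real_sqrt_unique) auto
  have \<delta>: "\<delta> = sqrt ((1 - c) ^ 3 * (3 + c)) / 2"
    unfolding \<delta>_def xi_inner_def s radicand_factor by (simp add: distrib_left)
  show *: "4 * \<delta>\<^sup>2 = (1 - c) ^ 3 * (3 + c)"
    unfolding \<delta> using assms(1) c1 by (simp add: power_divide)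
  have \<delta>0: "\<delta> \<ge> 0" unfolding \<delta> using assms(1) c1 by simp
  have s2: "s\<^sup>2 = (1 - c) * (1 + c)" using assms(3) by algebra
  \<comment> \<open>After squaring, a constant k in place of 7/10 needs 4 k^2 (1 + c) \<le> 3 + c;
    for c near 1 this forces k \<le> 1 / sqrt 2, and 7/10 lies just below.\<close>
  show "7 / 10 * (1 - c) * s \<le> \<delta>"
  proof (rule power2_le_imp_le [OF _ \<delta>0])
    have "4 * \<delta>\<^sup>2 - 4 * (7 / 10 * (1 - c) * s)\<^sup>2 = (1 - c) ^ 3 * (104 - 96 * c) / 100"
      unfolding * using s2 by algebra
    also have "\<dots> \<ge> 0" using c1 by simp
    finally show "(7 / 10 * (1 - c) * s)\<^sup>2 \<le> \<delta>\<^sup>2" by simp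
  qed
  show "2 * (s * \<delta>) < (1 - c)\<^sup>2 * (2 + c)"
  proof (rule power2_less_imp_less)
    have "(2 * (s * \<delta>))\<^sup>2 = s\<^sup>2 * (4 * \<delta>\<^sup>2)"
      by (simp add: power_mult_distrib)
    then have "((1 - c)\<^sup>2 * (2 + c))\<^sup>2 - (2 * (s * \<delta>))\<^sup>2 = (1 - c) ^ 4"
      unfolding s2 * by algebra
    also have "\<dots> > 0" using c1 by simp
    finally show "(2 * (s * \<delta>))\<^sup>2 < ((1 - c)\<^sup>2 * (2 + c))\<^sup>2" by simp
  qed (use assms(1) c1 in simp)
qed

text \<open>Touching at (1, 0) means c + \<xi> s + K/16 = 1. Multiplied by c this is a quadratic
  equation in \<xi>, with \<open>xi_inner c\<close> as its larger root.\<close>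

lemma xi_inner_coeffs:
  assumes "0 < c" "0 < s" "s\<^sup>2 + c\<^sup>2 = 1"
  shows "4 * cubic_coeff c s (xi_inner c) = quartic_coeff c s (xi_inner c) ^ 2"
    and "quartic_coeff c s (xi_inner c) > 0"
proof -
  define \<xi> where "\<xi> = xi_inner c"
  define \<delta> where "\<delta> = \<xi> - s * c / 2"
  define K where "K = quartic_coeff c s \<xi>"
  have \<xi>: "\<xi> = s * c / 2 + \<delta>" by (simp add: \<delta>_def)
  note b = xi_inner_bounds [OF assms, folded \<xi>_def, folded \<delta>_def]
  have cK: "c * K = 6 * s\<^sup>2 - 8 * \<xi> * s * c - 8 * \<xi>\<^sup>2"
    unfolding K_def using mult_quartic_coeff assms by auto
  have "c * K = c * (16 * (1 - c - \<xi> * s))"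
    using cK b(1) \<xi> assms(3) by algebra
  then have K: "K = 16 * (1 - c - \<xi> * s)" using assms(1) by simp
  have "K = 8 * ((1 - c)\<^sup>2 * (2 + c) - 2 * (s * \<delta>))"
    using K \<xi> assms(3) by algebra
  also have "\<dots> > 0" using b(3) by (simp only: zero_less_mult_iff diff_gt_0_iff_gt) simp
  finally show "quartic_coeff c s (xi_inner c) > 0"
    unfolding K_def \<xi>_def .
  have "K\<^sup>2 / 4 - cubic_coeff c s \<xi> = 64 * ((c + \<xi> * s + K / 16)\<^sup>2 - 1)"
    unfolding K_def using radial_error_0 assms by auto
  moreover have "c + \<xi> * s + K / 16 = 1" using K by (simp add: field_simps)
  ultimately show "4 * cubic_coeff c s (xi_inner c) = quartic_coeff c s (xi_inner c) ^ 2"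
    unfolding K_def \<xi>_def by simp
qed

section \<open>Growth of the cubic coefficient\<close>

lemma mult_cubic_coeff:
  assumes "c \<noteq> 0" "s\<^sup>2 + c\<^sup>2 = 1"
  shows "c * cubic_coeff c s \<xi>
    = 16 * c * s\<^sup>2 - \<xi> * s * (48 + 16 * c\<^sup>2) + 64 * c * \<xi>\<^sup>2 + 64 * s * \<xi> ^ 3"
  using mult_quartic_coeff [OF assms, of \<xi>] assms(2) unfolding cubic_coeff_def by algebra

lemma cubic_slope_pos:
  assumes "0 < c" "0 < s" "s\<^sup>2 + c\<^sup>2 = 1"
  shows "s * (48 + 16 * c\<^sup>2) < 128 * c * xi_inner c + 192 * s * (xi_inner c)\<^sup>2"
    \<comment> \<open>the derivative of \<open>\<lambda>\<xi>. c * cubic_coeff c s \<xi>\<close> is positive at \<open>xi_inner c\<close>\<close>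
proof -
  define \<delta> where "\<delta> = xi_inner c - s * c / 2"
  have \<xi>: "xi_inner c = s * c / 2 + \<delta>" by (simp add: \<delta>_def)
  note b = xi_inner_bounds [OF assms, folded \<delta>_def]
  have c1: "c < 1" using less_one_of_unit_circle assms by blast
  have pos: "0 < 7 / 10 * (1 - c) * s" using assms c1 by simp
  have "128 * c * (7 / 10 * (1 - c) * s) \<le> 128 * c * \<delta>"
    using b(2) assms(1) by (intro mult_left_mono) auto
  moreover have "0 \<le> 192 * s\<^sup>2 * c * \<delta>"
    using assms(1) b(2) pos by (intro mult_nonneg_nonneg) auto
  moreover have "128 * c * xi_inner c + 192 * s * (xi_inner c)\<^sup>2 - s * (48 + 16 * c\<^sup>2)
     = 128 * c * \<delta> + 192 * s\<^sup>2 * c * \<delta> - 48 * s * (1 - c)\<^sup>2 * (2 * c\<^sup>2 + 4 * c - 2)"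
  proof -
    have s2: "s\<^sup>2 = 1 - c\<^sup>2" using assms(3) by simp
    have "128 * c * xi_inner c + 192 * s * (xi_inner c)\<^sup>2 - s * (48 + 16 * c\<^sup>2)
      = 128 * c * \<delta> + 192 * s\<^sup>2 * c * \<delta> + 48 * s * (4 * \<delta>\<^sup>2) + 48 * s * (c\<^sup>2 + s\<^sup>2 * c\<^sup>2 - 1)"
      unfolding \<xi> by (simp add: power2_eq_square algebra_simps)
    also have "\<dots> = 128 * c * \<delta> + 192 * s\<^sup>2 * c * \<delta> - 48 * s * (1 - c)\<^sup>2 * (2 * c\<^sup>2 + 4 * c - 2)"
      unfolding b(1) s2 by algebra
    finally show ?thesis .
  qed
  moreover have "0 < s * (1 - c) * (448 / 5 * c - 48 * (1 - c) * (2 * c\<^sup>2 + 4 * c - 2))"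
  proof -
    \<comment> \<open>The first summand is 96 times c^3 minus its tangent line at 3/5. Completing
      the square in the remaining quadratic, with vertex 37/75, leaves a positive constant.\<close>
    have "448 / 5 * c - 48 * (1 - c) * (2 * c\<^sup>2 + 4 * c - 2)
      = 96 * (c - 3 / 5)\<^sup>2 * (c + 6 / 5) + 96 * (c - 37 / 75)\<^sup>2 + (6816 / 125 - 96 * (37 / 75)\<^sup>2)"
      by (simp add: power2_eq_square field_simps)
    also have "\<dots> > 0" using assms(1) by (intro add_nonneg_pos add_nonneg_nonneg) (auto simp: power2_eq_square)
    finally show ?thesis using assms(2) c1 by simp
  qed
  moreover have "128 * c * (7 / 10 * (1 - c) * s) - 48 * s * (1 - c)\<^sup>2 * (2 * c\<^sup>2 + 4 * c - 2)
     = s * (1 - c) * (448 / 5 * c - 48 * (1 - c) * (2 * c\<^sup>2 + 4 * c - 2))"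
    by algebra
  ultimately show ?thesis by linarith
qed

text \<open>The \<xi>^2 and \<xi>^3 coefficients of \<open>c * cubic_coeff c s \<xi>\<close> are
  positive, so for \<eta> > \<open>xi_inner c\<close> > 0 its difference quotient is at least the
  derivative at \<open>xi_inner c\<close>.\<close>

lemma cubic_coeff_gt:
  assumes "0 < c" "0 < s" "s\<^sup>2 + c\<^sup>2 = 1" "xi_inner c < \<eta>"
  shows "cubic_coeff c s (xi_inner c) < cubic_coeff c s \<eta>"
proof -
  define \<xi> where "\<xi> = xi_inner c"
  have c1: "c < 1" using less_one_of_unit_circle assms by blast
  have "0 < 7 / 10 * (1 - c) * s" "0 < s * c" using assms c1 by simp_all
  then have \<xi>0: "0 < \<xi>" using xi_inner_bounds(2) [OF assms(1-3)] unfolding \<xi>_def by linarith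
  have lt: "\<xi> < \<eta>" using assms(4) by (simp add: \<xi>_def)
  have "\<xi> * \<xi> \<le> \<xi> * \<eta>" "\<xi> * \<xi> \<le> \<eta> * \<eta>" using \<xi>0 lt by (auto intro: mult_mono)
  then have "64 * s * (3 * \<xi>\<^sup>2) \<le> 64 * s * (\<eta>\<^sup>2 + \<xi> * \<eta> + \<xi>\<^sup>2)"
    using assms(2) by (intro mult_left_mono) (auto simp: power2_eq_square)
  moreover have "64 * c * (2 * \<xi>) \<le> 64 * c * (\<eta> + \<xi>)"
    using assms(1) lt by (intro mult_left_mono) auto
  moreover have "s * (48 + 16 * c\<^sup>2) < 128 * c * \<xi> + 192 * s * \<xi>\<^sup>2"
    using cubic_slope_pos [OF assms(1-3)] by (simp add: \<xi>_def)
  ultimately have "0 < 64 * c * (\<eta> + \<xi>) + 64 * s * (\<eta>\<^sup>2 + \<xi> * \<eta> + \<xi>\<^sup>2) - s * (48 + 16 * c\<^sup>2)"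
    by linarith
  then have "0 < (\<eta> - \<xi>) * (64 * c * (\<eta> + \<xi>) + 64 * s * (\<eta>\<^sup>2 + \<xi> * \<eta> + \<xi>\<^sup>2) - s * (48 + 16 * c\<^sup>2))"
    using lt by simp
  also have "\<dots> = c * cubic_coeff c s \<eta> - c * cubic_coeff c s \<xi>"
    using assms(1) by (subst (1 2) mult_cubic_coeff [OF _ assms(3)]) (auto, algebra)
  finally show ?thesis using assms(1) by (simp add: \<xi>_def)
qed

section \<open>Optimality and uniqueness\<close>

lemma xi_inner_pos:
  assumes "0 < c" "c < 1"
  shows "0 < xi_inner c"
proof -
  have "c\<^sup>2 < 1" using assms by (simp add: abs_square_less_1)
  then have "0 < c * sqrt (1 - c\<^sup>2)" using assms by simp
  moreover have "0 \<le> sqrt (3 - 8 * c + 6 * c\<^sup>2 - c ^ 4)"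
    unfolding radicand_factor using assms by simp
  ultimately have "0 < c * sqrt (1 - c\<^sup>2) + sqrt (3 - 8 * c + 6 * c\<^sup>2 - c ^ 4)"
    by (rule add_pos_nonneg)
  then show ?thesis unfolding xi_inner_def by simp
qed

text \<open>Comparing errors at t = 1/2 suffices: the maximum for \<open>xi_inner c\<close> is
  attained there, and for \<eta> that value bounds the maximum from below. Strictness yields
  uniqueness of the optimum.\<close>

lemma max_radial_error_xi_inner_less:
  assumes "0 < c" "0 < s" "s\<^sup>2 + c\<^sup>2 = 1" "inner_approximant c s \<eta>" "\<eta> \<noteq> xi_inner c"
  shows "max_radial_error c s (xi_inner c) < max_radial_error c s \<eta>"
proof -
  let ?\<xi> = "xi_inner c"
  have c0: "c \<noteq> 0" using assms(1) by simp
  note co = xi_inner_coeffs [OF assms(1-3)]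
  have inner: "0 < \<eta>" "quartic_coeff c s \<eta> ^ 2 \<le> 4 * cubic_coeff c s \<eta>"
    using assms(4) inner_approximant_iff [OF c0 assms(3)] by auto
  have less: "cubic_coeff c s ?\<xi> - 3 / 16 * quartic_coeff c s ?\<xi> ^ 2
      < cubic_coeff c s \<eta> - 3 / 16 * quartic_coeff c s \<eta> ^ 2"
  proof (cases "quartic_coeff c s ?\<xi> ^ 2 < quartic_coeff c s \<eta> ^ 2")
    case True
    with co(1) inner(2) show ?thesis by linarith
  next
    case False
    have "\<not> \<eta> < ?\<xi>"
    proof
      assume "\<eta> < ?\<xi>"
      then have "quartic_coeff c s ?\<xi> < quartic_coeff c s \<eta>"
        using quartic_coeff_strict_antimono assms(1,2) inner(1) by blast
      then have "quartic_coeff c s ?\<xi> ^ 2 < quartic_coeff c s \<eta> ^ 2"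
        using co(2) by (intro power_strict_mono) auto
      with False show False by simp
    qed
    then have "cubic_coeff c s ?\<xi> < cubic_coeff c s \<eta>"
      using assms by (intro cubic_coeff_gt) auto
    with False show ?thesis by linarith
  qed
  have "0 \<le> cubic_coeff c s ?\<xi> - 3 / 16 * quartic_coeff c s ?\<xi> ^ 2"
    using co(1) zero_le_power2 [of "quartic_coeff c s ?\<xi>"] by linarith
  with less have "\<bar>radial_error c s (1/2) ?\<xi>\<bar> < \<bar>radial_error c s (1/2) \<eta>\<bar>"
    unfolding radial_error_half [OF c0 assms(3)] by (simp add: abs_mult)
  also have "\<dots> \<le> max_radial_error c s \<eta>"
    using c0 assms(3) by (intro radial_error_le_max) auto
  finally show ?thesis
    using max_radial_error_eq_half [OF c0 assms(3) co(1)] by simp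
qed

lemma optimal_inner_approximant_iff:
  assumes "0 < c" "0 < s" "s\<^sup>2 + c\<^sup>2 = 1"
  shows "optimal_inner_approximant c s \<xi> \<longleftrightarrow> \<xi> = xi_inner c"
proof -
  have "c < 1" using less_one_of_unit_circle assms by blast
  then have "inner_approximant c s (xi_inner c)"
    using xi_inner_pos xi_inner_coeffs(1) [OF assms] assms by (simp add: inner_approximant_iff)
  then show ?thesis
    unfolding optimal_inner_approximant_def
    using max_radial_error_xi_inner_less [OF assms] by (metis less_eq_real_def not_le)
qed

section \<open>Limits as c tends to 0\<close>

lemma xi_inner_tendsto: "(xi_inner \<longlongrightarrow> sqrt 3 / 2) (at_right 0)"
proof -
  have "(xi_inner \<longlongrightarrow> 1/2 * (0 * sqrt (1 - 0\<^sup>2) + sqrt (3 - 8 * 0 + 6 * 0\<^sup>2 - 0 ^ 4))) (at_right 0)"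
    unfolding xi_inner_def by (intro tendsto_intros)
  then show ?thesis by simp
qed

lemma middle_control_point_tendsto:
  "((\<lambda>c. control_point c (sqrt (1 - c\<^sup>2)) (xi_inner c) 2 $ 1) \<longlongrightarrow> 2/3 * (4 - sqrt 3)) (at_right 0)"
proof -
  let ?R = "\<lambda>c::real. sqrt (3 - 8 * c + 6 * c\<^sup>2 - c ^ 4)"
  \<comment> \<open>The abscissa has the form 0/0 at c = 0; \<open>?h\<close> is what remains after
    cancelling c, because the constant 3 drops out of 3 - 4 \<xi>^2.\<close>
  let ?h = "\<lambda>c::real. (8 - 7 * c + 2 * c ^ 3 - 2 * sqrt (1 - c\<^sup>2) * ?R c) / 3"
  have "(?h \<longlongrightarrow> (8 - 7 * 0 + 2 * 0 ^ 3 - 2 * sqrt (1 - 0\<^sup>2) * ?R 0) / 3) (at_right 0)"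
    by (intro tendsto_intros) auto
  then have "(?h \<longlongrightarrow> 2/3 * (4 - sqrt 3)) (at_right 0)" by (simp add: field_simps)
  moreover have "\<forall>\<^sub>F c in at_right (0::real). c \<in> {0<..<1}"
    by (rule eventually_at_right_real) simp
  then have "\<forall>\<^sub>F c in at_right 0.
      ?h c = control_point c (sqrt (1 - c\<^sup>2)) (xi_inner c) 2 $ 1"
  proof eventually_elim
    case (elim c)
    then have c: "0 < c" "c < 1" by auto
    have "c\<^sup>2 \<le> 1" using c by (simp add: abs_square_le_1)
    then have s: "(sqrt (1 - c\<^sup>2))\<^sup>2 = 1 - c\<^sup>2" by simp
    have R: "(?R c)\<^sup>2 = 3 - 8 * c + 6 * c\<^sup>2 - c ^ 4"
      unfolding radicand_factor using c by simp
    have "3 - 4 * (xi_inner c)\<^sup>2 = 3 * c * ?h c"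
      unfolding xi_inner_def using s R by algebra
    then show ?case using c by (simp add: control_point_def field_simps)
  qed
  ultimately show ?thesis by (rule Lim_transform_eventually)
qed

theorem mainTheorem5:
  shows "(\<forall>\<phi> \<xi>. 0 < \<phi> \<and> \<phi> < pi / 2 \<longrightarrow>
            (optimal_inner_approximant (cos \<phi>) (sin \<phi>) \<xi> \<longleftrightarrow> \<xi> = xi_inner (cos \<phi>)))
       \<and> (xi_inner \<longlongrightarrow> sqrt 3 / 2) (at_right 0)
       \<and> ((\<lambda>c. control_point c (sqrt (1 - c\<^sup>2)) (xi_inner c) 2 $ 1) \<longlongrightarrow> 2/3 * (4 - sqrt 3)) (at_right 0)"
  using xi_inner_tendsto middle_control_point_tendsto
  by (auto simp: optimal_inner_approximant_iff cos_gt_zero sin_gt_zero)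

end
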